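(* Let $t$ be real with $0<|t|\le 1/200$ and let $$\sigma=\frac{|0\rangle\langle0|+t^2|3\rangle\langle3|+\frac{9}{10}t\,(|0\rangle\langle3|+|3\rangle\langle0|)}{1+t^2}.$$ Then for every $(q,p)\in\mathbb R^2$, $$W_\sigma(q,p)\ge\frac{1/10-1801t^2}{1+t^2}\,W_0(q,p)>0,$$ and $$h(W_\sigma)-(1+\ln\pi)<-\frac{47}{100}t^2.$$
   Context: One bosonic mode on $L^2(\mathbb R)$ with $[\hat q,\hat p]=i$, $\hat a=(\hat q+i\hat p)/\sqrt2$; $|n\rangle$ are the Fock (number) states, $|n\rangle=(\hat a^\dagger)^n|0\rangle/\sqrt{n!}$ with $\hat a|0\rangle=0$. The Wigner function of a density operator is $W_\rho(q,p)=\frac1\pi\int_{\mathbb R}e^{2ipy}\langle q-y|\rho|q+y\rangle\,dy$, and $W_0(q,p)=\pi^{-1}e^{-q^2-p^2}$ is that of the vacuum. For $W_\rho\ge0$, $h(W_\rho)=-\int_{\mathbb R^2}W_\rho\ln W_\rho\,dq\,dp$ (natural logarithm); $h(W_0)=1+\ln\pi$. *)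

theory Defs
  imports "HOL-Probability.Probability"
begin

(* Schroedinger representation of one mode.  The operators act pointwise on wave functions; they
   are only ever applied to everywhere differentiable functions. *)

type_synonym wavefun = "real \<Rightarrow> complex"

definition q_op :: "wavefun \<Rightarrow> wavefun" where
  "q_op \<psi> = (\<lambda>x. of_real x * \<psi> x)"

definition p_op :: "wavefun \<Rightarrow> wavefun" where
  "p_op \<psi> = (\<lambda>x. - \<i> * vector_derivative \<psi> (at x))"

definition annihilation :: "wavefun \<Rightarrow> wavefun" where
  "annihilation \<psi> = (\<lambda>x. (q_op \<psi> x + \<i> * p_op \<psi> x) / of_real (sqrt 2))"

definition creation :: "wavefun \<Rightarrow> wavefun" where
  "creation \<psi> = (\<lambda>x. (q_op \<psi> x - \<i> * p_op \<psi> x) / of_real (sqrt 2))"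

(* The vacuum is determined only up to a global phase, hence a predicate.  Since the Bochner
   integral of a non-integrable function is 0, the last conjunct includes square integrability. *)
definition is_vacuum :: "wavefun \<Rightarrow> bool" where
  "is_vacuum \<psi> \<longleftrightarrow>
     (\<forall>x. \<psi> differentiable at x) \<and> annihilation \<psi> = (\<lambda>x. 0) \<and>
     (\<integral>x. (norm (\<psi> x))\<^sup>2 \<partial>lborel) = 1"

definition fock :: "wavefun \<Rightarrow> nat \<Rightarrow> wavefun" where
  "fock \<psi>0 n = (\<lambda>x. (creation ^^ n) \<psi>0 x / of_real (sqrt (fact n)))"

(* An operator \<rho> is represented by its position kernel, \<lambda>x y. \<langle>x|\<rho>|y\<rangle>. *)

type_synonym kernel = "real \<Rightarrow> real \<Rightarrow> complex"

definition ketbra :: "wavefun \<Rightarrow> wavefun \<Rightarrow> kernel" where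
  "ketbra \<phi> \<psi> = (\<lambda>x y. \<phi> x * cnj (\<psi> y))"

definition wigner :: "kernel \<Rightarrow> real \<times> real \<Rightarrow> complex" where
  "wigner \<rho> = (\<lambda>(q, p). 1 / of_real pi *
     (\<integral>y. exp (2 * \<i> * of_real p * of_real y) * \<rho> (q - y) (q + y) \<partial>lborel))"

definition W0 :: "real \<times> real \<Rightarrow> real" where
  "W0 = (\<lambda>(q, p). 1 / pi * exp (- q\<^sup>2 - p\<^sup>2))"

(* The value is meaningful only if the integrand is integrable. *)
definition diff_entropy :: "(real \<times> real \<Rightarrow> real) \<Rightarrow> real" where
  "diff_entropy W = - (\<integral>z. W z * ln (W z) \<partial>lborel)"

definition sigma_state :: "wavefun \<Rightarrow> real \<Rightarrow> kernel" where
  "sigma_state \<psi>0 t = (\<lambda>x y.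
     (ketbra (fock \<psi>0 0) (fock \<psi>0 0) x y
      + of_real (t\<^sup>2) * ketbra (fock \<psi>0 3) (fock \<psi>0 3) x y
      + of_real (9 / 10 * t) *
          (ketbra (fock \<psi>0 0) (fock \<psi>0 3) x y + ketbra (fock \<psi>0 3) (fock \<psi>0 0) x y))
     / of_real (1 + t\<^sup>2))"

lemma is_vacuum_gaussian:
  "is_vacuum (\<lambda>x. of_real (pi powr (-1/4) * exp (- x\<^sup>2 / 2)))"
proof -
  let ?g = "\<lambda>x::real. pi powr (-1/4) * exp (- x\<^sup>2 / 2)"
  have "(?g has_field_derivative - x * ?g x) (at x)" for x
    by (auto intro!: derivative_eq_intros)
  then have d: "((\<lambda>x. complex_of_real (?g x)) has_vector_derivative of_real (- x * ?g x)) (at x)" for x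
    by (intro has_vector_derivative_of_real)
      (simp add: has_real_derivative_iff_has_vector_derivative)
  have "(norm (complex_of_real (?g x)))\<^sup>2 = normal_density 0 (1 / sqrt 2) x" for x
  proof -
    have "(pi powr (-1/4))\<^sup>2 = 1 / sqrt pi"
      by (simp add: power2_eq_square powr_add [symmetric] powr_minus powr_half_sqrt field_simps)
    moreover have "(exp (- x\<^sup>2 / 2))\<^sup>2 = exp (- x\<^sup>2)"
      by (simp add: power2_eq_square flip: exp_add)
    ultimately have "(?g x)\<^sup>2 = 1 / sqrt pi * exp (- x\<^sup>2)"
      by (simp only: power_mult_distrib)
    moreover have "(norm (complex_of_real (?g x)))\<^sup>2 = (?g x)\<^sup>2"
      by (simp only: norm_of_real power2_abs)
    ultimately show ?thesis
      by (simp add: normal_density_def power_divide)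
  qed
  then have "(\<integral>x. (norm (complex_of_real (?g x)))\<^sup>2 \<partial>lborel) = 1"
    by (simp add: integral_normal_density)
  moreover have "(\<lambda>x. complex_of_real (?g x)) differentiable at x" for x
    using d by (rule differentiableI_vector)
  moreover have "annihilation (\<lambda>x. complex_of_real (?g x)) = (\<lambda>x. 0)"
    by (simp only: annihilation_def q_op_def p_op_def vector_derivative_at[OF d])
      (simp add: fun_eq_iff algebra_simps)
  ultimately show ?thesis
    unfolding is_vacuum_def by blast
qed

end

theory Submission
  imports Defs "HOL-Real_Asymp.Real_Asymp"
begin

text \<open>
  Solving the first-order equation \<open>annihilation \<psi> = 0\<close> makes the vacuum a Gaussian, so the Wigner
  integral of the state reduces to Fourier integrals of \<open>y\<^sup>k exp (- y\<^sup>2)\<close>, and \<open>W = W0 * G / (1 + t\<^sup>2)\<close> with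
  \<open>G = 1 + t\<^sup>2 A + (9/10) t B\<close>, where \<open>A = - L\<^sub>3 (2 r\<^sup>2)\<close> and \<open>B = (4 / sqrt 3) Re ((q + i p)\<^sup>3)\<close>.
  Since \<open>ln W0\<close> is affine in \<open>r\<^sup>2\<close>, the entropy equals \<open>ln pi\<close> plus the mean of \<open>r\<^sup>2\<close> minus the
  relative entropy to the vacuum. The mean energy contributes about \<open>6 t\<^sup>2\<close>, while the bound
  \<open>(1 + x) ln (1 + x) \<ge> x + x\<^sup>2 / 2 - x\<^sup>3 / 6\<close> reduces the relative entropy to Gaussian moments and shows
  that it is at least about \<open>6.48 t\<^sup>2\<close>; the error terms are of order \<open>t\<^sup>4\<close>.
\<close>

subsection \<open>Wave functions and Gaussian Fourier integrals\<close>

lemma vacuum_derivative: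
  assumes "is_vacuum \<psi>"
  shows "(\<psi> has_vector_derivative - of_real x * \<psi> x) (at x)"
proof -
  have "annihilation \<psi> x = 0"
    using assms by (simp add: is_vacuum_def)
  then have "vector_derivative \<psi> (at x) = - of_real x * \<psi> x"
    by (simp add: annihilation_def q_op_def p_op_def add_eq_0_iff)
  moreover have "\<psi> differentiable at x"
    using assms by (simp add: is_vacuum_def)
  ultimately show ?thesis
    by (metis vector_derivative_works)
qed

text \<open>The integrating factor \<open>exp (x\<^sup>2 / 2)\<close> turns the vacuum equation into
  a vanishing derivative. Normalisation fixes only the modulus of \<open>c\<close>; the phase stays
  free and cancels later, because kernels contain \<open>c\<close> only through
  \<open>c * cnj c\<close>.\<close>

lemma vacuum_eq_gaussian:
  assumes "is_vacuum \<psi>"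
  obtains c where "\<psi> = (\<lambda>x. c * of_real (exp (- x\<^sup>2 / 2)))" "c * cnj c = of_real (1 / sqrt pi)"
proof -
  let ?g = "\<lambda>x::real. of_real (exp (x\<^sup>2 / 2)) * \<psi> x"
  have g: "((\<lambda>x. complex_of_real (exp (x\<^sup>2 / 2))) has_vector_derivative of_real (x * exp (x\<^sup>2 / 2))) (at x)"
    for x :: real
    by (intro has_vector_derivative_of_real)
       (auto simp flip: has_real_derivative_iff_has_vector_derivative intro!: derivative_eq_intros)
  have "(?g has_vector_derivative 0) (at x)" for x
    by (rule derivative_eq_intros g vacuum_derivative[OF assms])+ simp
  then obtain c where c: "?g x = c" for x
    using has_vector_derivative_zero_constant[of UNIV ?g] by auto
  have \<psi>: "\<psi> x = c * of_real (exp (- x\<^sup>2 / 2))" for x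
    using c[of x, symmetric] by (simp add: exp_minus)
  have "(norm (\<psi> x))\<^sup>2 = (norm c)\<^sup>2 * sqrt pi * normal_density 0 (1 / sqrt 2) x" for x
    by (simp add: \<psi> normal_density_def norm_mult power_mult_distrib power_divide)
       (simp add: power2_eq_square flip: exp_add)
  then have "(\<integral>x. (norm (\<psi> x))\<^sup>2 \<partial>lborel) = (norm c)\<^sup>2 * sqrt pi"
    by (simp add: integral_normal_density)
  with assms have "(norm c)\<^sup>2 = 1 / sqrt pi"
    by (simp add: is_vacuum_def field_simps)
  then have "c * cnj c = of_real (1 / sqrt pi)"
    by (metis complex_norm_square)
  with \<psi> show ?thesis using that by blast
qed

text \<open>By \<open>vacuum_derivative\<close>, differentiating \<open>\<psi>\<close> just
  multiplies it by \<open>- x\<close>, so creation acts on the prefactor alone and Fock states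
  follow from a polynomial recursion.\<close>

lemma creation_mult_vacuum:
  assumes "is_vacuum \<psi>" and "\<And>x. (f has_real_derivative f' x) (at x)"
  shows "creation (\<lambda>x. of_real (f x) * \<psi> x) = (\<lambda>x. of_real ((2 * x * f x - f' x) / sqrt 2) * \<psi> x)"
proof -
  have "((\<lambda>x. complex_of_real (f x)) has_vector_derivative of_real (f' x)) (at x)" for x
    using assms(2)[of x] by (intro has_vector_derivative_of_real)
      (simp add: has_real_derivative_iff_has_vector_derivative)
  then have "((\<lambda>x. of_real (f x) * \<psi> x) has_vector_derivative
      of_real (f x) * (- of_real x * \<psi> x) + of_real (f' x) * \<psi> x) (at x)" for x
    by (intro has_vector_derivative_mult vacuum_derivative assms)
  from vector_derivative_at[OF this] show ?thesis
    by (simp add: creation_def q_op_def p_op_def fun_eq_iff field_simps)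
qed

lemma fock_0: "fock \<psi> 0 = \<psi>"
  by (simp add: fock_def)

text \<open>Three rounds of that recursion, started from the prefactor 1. The result is the Hermite
  polynomial H_3 divided by sqrt (2^3 * 3!).\<close>

lemma fock_3:
  assumes "is_vacuum \<psi>"
  shows "fock \<psi> 3 = (\<lambda>x. of_real ((2 * x ^ 3 - 3 * x) / sqrt 3) * \<psi> x)"
proof -
  have "2 / sqrt 2 = sqrt 2"
    by (simp add: real_div_sqrt)
  then have two_div_sqrt2: "2 / complex_of_real (sqrt 2) = of_real (sqrt 2)"
    by (metis of_real_divide of_real_numeral)
  have c1: "creation \<psi> = (\<lambda>x. of_real (sqrt 2 * x) * \<psi> x)"
    using creation_mult_vacuum[OF assms, of "\<lambda>_. 1" "\<lambda>_. 0"]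
    by (simp add: fun_eq_iff two_div_sqrt2 flip: times_divide_eq_left)
  have c2: "creation (\<lambda>x. of_real (sqrt 2 * x) * \<psi> x) = (\<lambda>x. of_real (2 * x\<^sup>2 - 1) * \<psi> x)"
    by (subst creation_mult_vacuum[OF assms, where f' = "\<lambda>_. sqrt 2"])
       (auto intro!: derivative_eq_intros simp: field_simps power2_eq_square fun_eq_iff)
  have c3: "creation (\<lambda>x. of_real (2 * x\<^sup>2 - 1) * \<psi> x) = (\<lambda>x. of_real (sqrt 2 * (2 * x ^ 3 - 3 * x)) * \<psi> x)"
  proof -
    have "((\<lambda>x. 2 * x\<^sup>2 - 1) has_real_derivative 4 * x) (at x)" for x :: real
      by (auto intro!: derivative_eq_intros)
    moreover have "(2 * x * (2 * x\<^sup>2 - 1) - 4 * x) / sqrt 2 = sqrt 2 * (2 * x ^ 3 - 3 * x)" for x :: real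
      by (simp add: field_simps power2_eq_square power3_eq_cube)
    ultimately show ?thesis
      using creation_mult_vacuum[OF assms, of "\<lambda>x. 2 * x\<^sup>2 - 1" "\<lambda>x. 4 * x"] by (simp only:)
  qed
  have "(creation ^^ 3) \<psi> = creation (creation (creation \<psi>))"
    by (simp add: numeral_3_eq_3)
  also have "\<dots> = (\<lambda>x. of_real (sqrt 2 * (2 * x ^ 3 - 3 * x)) * \<psi> x)"
    by (simp only: c1 c2 c3)
  finally have "(creation ^^ 3) \<psi> = (\<lambda>x. of_real (sqrt 2 * (2 * x ^ 3 - 3 * x)) * \<psi> x)" .
  moreover have "sqrt (fact 3) = sqrt 2 * sqrt 3"
    by (simp add: fact_numeral flip: real_sqrt_mult)
  ultimately show ?thesis
    by (simp add: fock_def fun_eq_iff)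
qed

text \<open>Building blocks into which the Wigner integrand splits after expansion in powers of
  \<open>y\<close>; the factor 2 in the exponent is that of the Wigner transform.\<close>

definition gauss_fourier :: "real \<Rightarrow> nat \<Rightarrow> real \<Rightarrow> complex" where
  "gauss_fourier p k y = of_real (y ^ k * exp (- y\<^sup>2)) * exp (2 * \<i> * of_real p * of_real y)"

lemma norm_gauss_fourier: "norm (gauss_fourier p k y) = \<bar>y\<bar> ^ k * exp (- y\<^sup>2)"
  by (simp add: gauss_fourier_def norm_mult norm_power power_abs)

lemma continuous_gauss_fourier: "continuous_on S (gauss_fourier p k)"
  unfolding gauss_fourier_def by (intro continuous_intros)

lemma integrable_gauss_fourier: "integrable lborel (gauss_fourier p k)"
proof (rule Bochner_Integration.integrable_bound)
  \<comment> \<open>\<open>exp (- y\<^sup>2)\<close> is \<open>sqrt pi\<close> times the normal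
    density of variance 1/2, so an absolute normal moment supplies the dominating function.\<close>
  have "integrable lborel (\<lambda>y. sqrt pi * (normal_density 0 (1 / sqrt 2) y * \<bar>y - 0\<bar> ^ k))"
    by (intro integrable_mult_right integrable_normal_moment_abs) simp
  then show "integrable lborel (\<lambda>y::real. \<bar>y\<bar> ^ k * exp (- y\<^sup>2))"
    by (simp add: normal_density_def power_divide mult.commute)
  show "gauss_fourier p k \<in> borel_measurable lborel"
    by (simp add: borel_measurable_continuous_onI continuous_gauss_fourier)
qed (simp add: norm_gauss_fourier)

text \<open>This is the characteristic function of the standard normal law at
  \<open>sqrt 2 * p\<close>, rescaled by x = sqrt 2 * y.\<close>

lemma gauss_fourier_0: "(\<integral>y. gauss_fourier p 0 y \<partial>lborel) = of_real (sqrt pi * exp (- p\<^sup>2))"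
proof -
  have "of_real (exp (- p\<^sup>2)) = char std_normal_distribution (sqrt 2 * p)"
    by (simp add: char_std_normal_distribution power_mult_distrib)
  also have "\<dots> = (\<integral>x. std_normal_density x *\<^sub>R iexp (sqrt 2 * p * x) \<partial>lborel)"
    unfolding char_def by (subst integral_density) auto
  also have "\<dots> = \<bar>sqrt 2\<bar> *\<^sub>R (\<integral>y. std_normal_density (0 + sqrt 2 * y) *\<^sub>R iexp (sqrt 2 * p * (0 + sqrt 2 * y)) \<partial>lborel)"
    by (rule lborel_integral_real_affine) simp
  also have "\<dots> = \<bar>sqrt 2\<bar> *\<^sub>R (\<integral>y. of_real (1 / (sqrt 2 * sqrt pi)) * gauss_fourier p 0 y \<partial>lborel)"
  proof (intro arg_cong2[where f = "(*\<^sub>R)"] Bochner_Integration.integral_cong refl)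
    fix y :: real
    have "\<i> * of_real (sqrt 2 * p * (0 + sqrt 2 * y)) = 2 * \<i> * of_real p * of_real y"
    proof -
      have "sqrt 2 * p * (0 + sqrt 2 * y) = 2 * (p * y)"
        by simp
      then show ?thesis
        by (simp only: of_real_mult of_real_numeral mult_ac)
    qed
    then have "iexp (sqrt 2 * p * (0 + sqrt 2 * y)) = exp (2 * \<i> * of_real p * of_real y)"
      by (simp only:)
    then show "std_normal_density (0 + sqrt 2 * y) *\<^sub>R iexp (sqrt 2 * p * (0 + sqrt 2 * y)) =
        of_real (1 / (sqrt 2 * sqrt pi)) * gauss_fourier p 0 y"
      by (simp only:) (simp add: gauss_fourier_def std_normal_density_def real_sqrt_mult power_mult_distrib scaleR_conv_of_real)
  qed
  finally show ?thesis
    by (simp add: scaleR_conv_of_real field_simps)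
qed

lemma gauss_fourier_derivative:
  "(gauss_fourier p k has_vector_derivative
     of_nat k * gauss_fourier p (k - 1) y + 2 * \<i> * of_real p * gauss_fourier p k y
       - 2 * gauss_fourier p (Suc k) y) (at y)"
proof -
  have 1: "((\<lambda>y. complex_of_real (y ^ k * exp (- y\<^sup>2))) has_vector_derivative
      of_real (of_nat k * y ^ (k - 1) * exp (- y\<^sup>2) - 2 * y * y ^ k * exp (- y\<^sup>2))) (at y)"
    by (intro has_vector_derivative_of_real)
       (auto simp flip: has_real_derivative_iff_has_vector_derivative intro!: derivative_eq_intros)
  have 2: "((\<lambda>y. exp (2 * \<i> * of_real p * of_real y)) has_vector_derivative
      2 * \<i> * of_real p * exp (2 * \<i> * of_real p * of_real y)) (at y)"
    by (intro has_vector_derivative_real_field) (auto intro!: derivative_eq_intros)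
  show ?thesis
    unfolding gauss_fourier_def
    by (rule has_vector_derivative_eq_rhs[OF has_vector_derivative_mult[OF 1 2]])
       (simp add: algebra_simps)
qed

text \<open>Integration by parts: the derivative in \<open>gauss_fourier_derivative\<close> has
  integral 0 because \<open>gauss_fourier p k\<close> decays at both ends, and solving for the
  highest power gives the recursion. At \<open>k = 0\<close> the truncated index
  \<open>k - 1\<close> is harmless, as its coefficient \<open>of_nat k\<close> is 0.\<close>

lemma gauss_fourier_Suc:
  "(\<integral>y. gauss_fourier p (Suc k) y \<partial>lborel) =
     \<i> * of_real p * (\<integral>y. gauss_fourier p k y \<partial>lborel) + of_nat k / 2 * (\<integral>y. gauss_fourier p (k - 1) y \<partial>lborel)"
proof -
  let ?F' = "\<lambda>y. of_nat k * gauss_fourier p (k - 1) y + 2 * \<i> * of_real p * gauss_fourier p k y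
       - 2 * gauss_fourier p (Suc k) y"
  have int: "integrable lborel ?F'"
    by (intro Bochner_Integration.integrable_add Bochner_Integration.integrable_diff
          integrable_mult_right integrable_gauss_fourier)
  have lim: "((\<lambda>y. norm (gauss_fourier p k y)) \<longlongrightarrow> 0) at_top" "((\<lambda>y. norm (gauss_fourier p k y)) \<longlongrightarrow> 0) at_bot"
    unfolding norm_gauss_fourier by real_asymp+
  have "(LBINT y=-\<infinity>..\<infinity>. ?F' y) = 0 - 0"
  proof (rule interval_integral_FTC_integrable)
    show "isCont ?F' x" for x
      using continuous_gauss_fourier[of UNIV]
      by (intro continuous_intros) (auto simp: continuous_on_eq_continuous_at)
    show "set_integrable lborel (einterval (-\<infinity>) \<infinity>) ?F'"
      using int by (simp add: set_integrable_def)
    show "((gauss_fourier p k \<circ> real_of_ereal) \<longlongrightarrow> 0) (at_right (-\<infinity>))"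
      using lim(2) by (simp add: ereal_tendsto_simps tendsto_norm_zero_iff)
    show "((gauss_fourier p k \<circ> real_of_ereal) \<longlongrightarrow> 0) (at_left \<infinity>)"
      using lim(1) by (simp add: ereal_tendsto_simps tendsto_norm_zero_iff)
  qed (rule gauss_fourier_derivative | simp)+
  then have "(\<integral>y. ?F' y \<partial>lborel) = 0"
    by (simp add: interval_lebesgue_integral_def set_lebesgue_integral_def)
  then show ?thesis
    by (simp add: integrable_gauss_fourier integrable_mult_right field_simps)
qed

subsection \<open>Moments of the vacuum Wigner function\<close>

lemma has_bochner_integral_lborel_prod:
  fixes f g :: "real \<Rightarrow> real"
  assumes f: "has_bochner_integral lborel f a" and g: "has_bochner_integral lborel g b"
  shows "has_bochner_integral lborel (\<lambda>z. f (fst z) * g (snd z)) (a * b)"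
proof -
  have [measurable]: "f \<in> borel_measurable lborel" "g \<in> borel_measurable lborel"
    using f g by (blast dest: has_bochner_integral_iff[THEN iffD1] borel_measurable_integrable)+
  have int: "integrable (lborel \<Otimes>\<^sub>M lborel) (\<lambda>z. f (fst z) * g (snd z))"
    using f g by (intro lborel_pair.Fubini_integrable) (auto simp: has_bochner_integral_iff abs_mult)
  from lborel_pair.integral_fst'[OF int] f g
  have "integral\<^sup>L (lborel \<Otimes>\<^sub>M lborel) (\<lambda>z. f (fst z) * g (snd z)) = a * b"
    by (simp add: has_bochner_integral_iff)
  with int show ?thesis
    by (simp add: has_bochner_integral_iff lborel_prod)
qed

text \<open>Moments of the centred normal law of variance 1/2. The rising factorial equals (2j)! /
  (4^j j!) for \<open>k = 2 * j\<close> and is the form to which the Vandermonde identity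
  applies.\<close>

definition gauss_moment :: "nat \<Rightarrow> real" where
  "gauss_moment k = (if even k then pochhammer (1 / 2) (k div 2) else 0)"

lemma has_bochner_integral_gauss_moment:
  "has_bochner_integral lborel (\<lambda>x. normal_density 0 (1 / sqrt 2) x * x ^ k) (gauss_moment k)"
proof (cases "even k")
  case True
  then obtain j where j: "k = 2 * j" by blast
  have "gauss_moment k = fact (2 * j) / ((2 / (1 / sqrt 2)\<^sup>2) ^ j * fact j)"
    by (simp add: j gauss_moment_def fact_double power_divide power_mult)
  then show ?thesis
    using normal_moment_even[of "1 / sqrt 2" 0 j] by (simp add: j)
next
  case False
  then obtain j where "k = 2 * j + 1" by (auto elim: oddE)
  with False show ?thesis
    using normal_moment_odd[of "1 / sqrt 2" 0 j] by (simp add: gauss_moment_def)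
qed

text \<open>Expectation under the vacuum Wigner function. A predicate, rather than a function,
  carries integrability and value together through linear combinations.\<close>

definition mean :: "(real \<times> real \<Rightarrow> real) \<Rightarrow> real \<Rightarrow> bool" where
  "mean f v \<longleftrightarrow> has_bochner_integral lborel (\<lambda>z. W0 z * f z) v"

lemma mean_add: "mean f v \<Longrightarrow> mean g w \<Longrightarrow> mean (\<lambda>z. f z + g z) (v + w)"
  unfolding mean_def distrib_left by (rule has_bochner_integral_add)

lemma mean_cmult: "mean f v \<Longrightarrow> mean (\<lambda>z. c * f z) (c * v)"
  unfolding mean_def by (simp add: mult.left_commute[of _ c] has_bochner_integral_mult_right)

lemma mean_sum: "(\<And>i. i \<in> I \<Longrightarrow> mean (f i) (v i)) \<Longrightarrow> mean (\<lambda>z. \<Sum>i\<in>I. f i z) (\<Sum>i\<in>I. v i)"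
  unfolding mean_def sum_distrib_left by (rule has_bochner_integral_sum)

text \<open>Pattern of the polynomial moments below: state the moment for an explicit combination of
  known ones, then match function and value separately.\<close>

lemma mean_eqI: "mean f v \<Longrightarrow> (\<And>q p. f (q, p) = g (q, p)) \<Longrightarrow> v = w \<Longrightarrow> mean g w"
  by (metis ext old.prod.exhaust)

definition rsq :: "real \<times> real \<Rightarrow> real" where "rsq z = (fst z)\<^sup>2 + (snd z)\<^sup>2"

text \<open>Real part of (q + i p)^3, the angular dependence cos (3 theta) of the interference
  between the Fock states 0 and 3.\<close>

definition re_cube :: "real \<times> real \<Rightarrow> real" where "re_cube z = fst z ^ 3 - 3 * fst z * (snd z)\<^sup>2"

lemma W0_eq_normal_density:
  "W0 z = normal_density 0 (1 / sqrt 2) (fst z) * normal_density 0 (1 / sqrt 2) (snd z)"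
  by (simp add: W0_def normal_density_def power_divide split_beta flip: exp_add)

lemma mean_monomial: "mean (\<lambda>z. fst z ^ a * snd z ^ b) (gauss_moment a * gauss_moment b)"
  using has_bochner_integral_lborel_prod[OF has_bochner_integral_gauss_moment[of a] has_bochner_integral_gauss_moment[of b]]
  by (simp add: mean_def W0_eq_normal_density mult_ac)

lemma mean_rsq_monomial:
  "mean (\<lambda>z. rsq z ^ n * (fst z ^ a * snd z ^ b))
     (\<Sum>k\<le>n. of_nat (n choose k) * (gauss_moment (2 * k + a) * gauss_moment (2 * (n - k) + b)))"
proof (rule mean_eqI[OF mean_sum])
  show "mean (\<lambda>z. of_nat (n choose k) * (fst z ^ (2 * k + a) * snd z ^ (2 * (n - k) + b)))
     (of_nat (n choose k) * (gauss_moment (2 * k + a) * gauss_moment (2 * (n - k) + b)))" for k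
    by (intro mean_cmult mean_monomial)
  fix q p :: real
  have "rsq (q, p) ^ n = (\<Sum>k\<le>n. of_nat (n choose k) * q ^ (2 * k) * p ^ (2 * (n - k)))"
    by (simp only: rsq_def fst_conv snd_conv binomial_ring power_mult)
  then show "(\<Sum>k\<le>n. of_nat (n choose k) * (fst (q, p) ^ (2 * k + a) * snd (q, p) ^ (2 * (n - k) + b))) =
    rsq (q, p) ^ n * (fst (q, p) ^ a * snd (q, p) ^ b)"
    by (simp add: sum_distrib_left sum_distrib_right power_add mult_ac)
qed simp

text \<open>The sum over the binomial expansion collapses by the Vandermonde identity for rising factorials.\<close>

lemma mean_rsq_even:
  "mean (\<lambda>z. rsq z ^ n * (fst z ^ (2 * a) * snd z ^ (2 * b)))
     (pochhammer (1 / 2) a * pochhammer (1 / 2) b * pochhammer (1 + real a + real b) n)"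
proof (rule mean_eqI[OF mean_rsq_monomial])
  have "(\<Sum>k\<le>n. real (n choose k) * (gauss_moment (2 * k + 2 * a) * gauss_moment (2 * (n - k) + 2 * b))) =
    (\<Sum>k\<le>n. pochhammer (1 / 2) a * pochhammer (1 / 2) b *
      (real (n choose k) * pochhammer (1 / 2 + real a) k * pochhammer (1 / 2 + real b) (n - k)))"
  proof (rule sum.cong[OF refl])
    fix k
    have "gauss_moment (2 * j + 2 * c) = pochhammer (1 / 2) c * pochhammer (1 / 2 + real c) j" for j c
    proof -
      have "gauss_moment (2 * j + 2 * c) = pochhammer (1 / 2) (c + j)"
        by (simp add: gauss_moment_def add.commute)
      then show ?thesis
        by (simp only: pochhammer_product')
    qed
    then show "real (n choose k) * (gauss_moment (2 * k + 2 * a) * gauss_moment (2 * (n - k) + 2 * b)) =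
      pochhammer (1 / 2) a * pochhammer (1 / 2) b *
      (real (n choose k) * pochhammer (1 / 2 + real a) k * pochhammer (1 / 2 + real b) (n - k))"
      by (simp only: mult_ac)
  qed
  also have "\<dots> = pochhammer (1 / 2) a * pochhammer (1 / 2) b * pochhammer ((1 / 2 + real a) + (1 / 2 + real b)) n"
    by (simp only: pochhammer_binomial_sum sum_distrib_left)
  also have "(1 / 2 + real a) + (1 / 2 + real b) = 1 + real a + real b"
    by simp
  finally show "(\<Sum>k\<le>n. real (n choose k) * (gauss_moment (2 * k + 2 * a) * gauss_moment (2 * (n - k) + 2 * b))) =
    pochhammer (1 / 2) a * pochhammer (1 / 2) b * pochhammer (1 + real a + real b) n" .
qed simp

lemma mean_rsq_odd: "odd a \<Longrightarrow> mean (\<lambda>z. rsq z ^ n * (fst z ^ a * snd z ^ b)) 0"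
  by (rule mean_eqI[OF mean_rsq_monomial refl]) (auto simp: gauss_moment_def)

text \<open>Under the vacuum Wigner function \<open>rsq\<close> is exponentially distributed with
  mean 1.\<close>

lemma mean_rsq_power: "mean (\<lambda>z. rsq z ^ n) (fact n)"
  using mean_rsq_even[of n 0 0] by (simp add: pochhammer_fact)

text \<open>Both monomials of \<open>re_cube\<close> are odd in q, so the reflection q to -q kills
  the mean.\<close>

lemma mean_rsq_re_cube: "mean (\<lambda>z. rsq z ^ n * re_cube z) 0"
proof (rule mean_eqI)
  show "mean (\<lambda>z. rsq z ^ n * (fst z ^ 3 * snd z ^ 0) + (-3) * (rsq z ^ n * (fst z ^ 1 * snd z ^ 2))) (0 + (-3) * 0)"
    by (intro mean_add mean_cmult mean_rsq_odd) auto
qed (auto simp: re_cube_def algebra_simps)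

lemma mean_re_cube_cubed: "mean (\<lambda>z. re_cube z ^ 3) 0"
proof (rule mean_eqI)
  show "mean (\<lambda>z. rsq z ^ 0 * (fst z ^ 9 * snd z ^ 0) + ((-9) * (rsq z ^ 0 * (fst z ^ 7 * snd z ^ 2))
     + (27 * (rsq z ^ 0 * (fst z ^ 5 * snd z ^ 4)) + (-27) * (rsq z ^ 0 * (fst z ^ 3 * snd z ^ 6)))))
     (0 + ((-9) * 0 + (27 * 0 + (-27) * 0)))"
    by (intro mean_add mean_cmult mean_rsq_odd) auto
qed (auto simp: re_cube_def power3_eq_cube eval_nat_numeral algebra_simps)

text \<open>The value reflects that cos^2 (3 theta) has angular mean 1/2, which leaves half the
  moment of \<open>rsq\<close> of order \<open>n + 3\<close>.\<close>

lemma mean_rsq_re_cube_sq: "mean (\<lambda>z. rsq z ^ n * (re_cube z)\<^sup>2) (fact (n + 3) / 2)"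
proof (rule mean_eqI)
  let ?e = "\<lambda>a b. pochhammer (1 / 2) a * pochhammer (1 / 2) b * pochhammer (1 + real a + real b) n"
  show "mean (\<lambda>z. rsq z ^ n * (fst z ^ (2 * 3) * snd z ^ (2 * 0)) + ((-6) * (rsq z ^ n * (fst z ^ (2 * 2) * snd z ^ (2 * 1)))
     + 9 * (rsq z ^ n * (fst z ^ (2 * 1) * snd z ^ (2 * 2))))) (?e 3 0 + ((-6) * ?e 2 1 + 9 * ?e 1 2))"
    by (intro mean_add mean_cmult mean_rsq_even)
  \<comment> \<open>All three monomials have \<open>a + b = 3\<close>, hence the common factor
    \<open>pochhammer 4 n\<close>; their coefficients 15/8 - 9/4 + 27/8 add up to 3, half of
    \<open>fact 3\<close>.\<close>
  have "fact (n + 3) = (fact 3 :: real) * pochhammer (1 + of_nat 3) n"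
    using pochhammer_product'[of "1::real" 3 n] by (simp only: pochhammer_fact add.commute[of n])
  moreover have "fact 3 = (6 :: real)"
    by (simp add: fact_numeral)
  ultimately show "?e 3 0 + ((-6) * ?e 2 1 + 9 * ?e 1 2) = fact (n + 3) / 2"
    by (simp add: numeral_2_eq_2 numeral_3_eq_3 pochhammer_Suc del: fact_Suc)
  have sq: "(re_cube (q, p))\<^sup>2 = q ^ 6 - 6 * (q ^ 4 * p\<^sup>2) + 9 * (q\<^sup>2 * p ^ 4)" for q p :: real
    unfolding re_cube_def fst_conv snd_conv by algebra
  show "rsq (q, p) ^ n * (fst (q, p) ^ (2 * 3) * snd (q, p) ^ (2 * 0)) +
      ((-6) * (rsq (q, p) ^ n * (fst (q, p) ^ (2 * 2) * snd (q, p) ^ (2 * 1))) +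
      9 * (rsq (q, p) ^ n * (fst (q, p) ^ (2 * 1) * snd (q, p) ^ (2 * 2)))) =
      rsq (q, p) ^ n * (re_cube (q, p))\<^sup>2" for q p :: real
    by (simp only: sq fst_conv snd_conv) (simp add: algebra_simps power2_eq_square)
qed

text \<open>Equal to - L_3 (2 r) with the Laguerre polynomial L_3; at \<open>r = rsq z\<close> it is
  the Wigner function of the Fock state 3 divided by \<open>W0\<close>.\<close>

definition fock3_poly :: "real \<Rightarrow> real" where
  "fock3_poly r = -1 + 6 * r - 6 * r\<^sup>2 + 4 / 3 * r ^ 3"

section \<open>Moments of the Fock-state polynomial and of its products with the interference
  term\<close>

lemma mean_fock3_poly: "mean (\<lambda>z. fock3_poly (rsq z)) 1"
proof (rule mean_eqI)
  show "mean (\<lambda>z. (-1) * (rsq z ^ 0) + ((6) * (rsq z ^ 1) + ((-6) * (rsq z ^ 2) + ((4/3) * (rsq z ^ 3)))))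
    ((-1) * fact 0 + ((6) * fact 1 + ((-6) * fact 2 + ((4/3) * fact 3))))"
    by (intro mean_add mean_cmult mean_rsq_power)
  show "(-1) * fact 0 + ((6) * fact 1 + ((-6) * fact 2 + ((4/3) * fact 3))) = (1 :: real)"
    by (simp add: fact_numeral)
qed (unfold fock3_poly_def, algebra)

text \<open>The value is 2 * 3 + 1, the expectation of q^2 + p^2 in the Fock state 3.\<close>

lemma mean_fock3_poly_rsq: "mean (\<lambda>z. fock3_poly (rsq z) * rsq z) 7"
proof (rule mean_eqI)
  show "mean (\<lambda>z. (0) * (rsq z ^ 0) + ((-1) * (rsq z ^ 1) + ((6) * (rsq z ^ 2) + ((-6) * (rsq z ^ 3) + ((4/3) * (rsq z ^ 4))))))
    ((0) * fact 0 + ((-1) * fact 1 + ((6) * fact 2 + ((-6) * fact 3 + ((4/3) * fact 4)))))"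
    by (intro mean_add mean_cmult mean_rsq_power)
  show "(0) * fact 0 + ((-1) * fact 1 + ((6) * fact 2 + ((-6) * fact 3 + ((4/3) * fact 4)))) = (7 :: real)"
    by (simp add: fact_numeral)
qed (unfold fock3_poly_def, algebra)

lemma mean_fock3_poly_sq: "mean (\<lambda>z. (fock3_poly (rsq z))\<^sup>2) 245"
proof (rule mean_eqI)
  show "mean (\<lambda>z. (1) * (rsq z ^ 0) + ((-12) * (rsq z ^ 1) + ((48) * (rsq z ^ 2) + ((-224/3) * (rsq z ^ 3) + ((52) * (rsq z ^ 4) + ((-16) * (rsq z ^ 5) + ((16/9) * (rsq z ^ 6))))))))
    ((1) * fact 0 + ((-12) * fact 1 + ((48) * fact 2 + ((-224/3) * fact 3 + ((52) * fact 4 + ((-16) * fact 5 + ((16/9) * fact 6)))))))"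
    by (intro mean_add mean_cmult mean_rsq_power)
  show "(1) * fact 0 + ((-12) * fact 1 + ((48) * fact 2 + ((-224/3) * fact 3 + ((52) * fact 4 + ((-16) * fact 5 + ((16/9) * fact 6)))))) = (245 :: real)"
    by (simp add: fact_numeral)
qed (unfold fock3_poly_def, algebra)

lemma mean_fock3_poly_cubed: "mean (\<lambda>z. fock3_poly (rsq z) ^ 3) 174125"
proof (rule mean_eqI)
  show "mean (\<lambda>z. (-1) * (rsq z ^ 0) + ((18) * (rsq z ^ 1) + ((-126) * (rsq z ^ 2) + ((436) * (rsq z ^ 3) + ((-804) * (rsq z ^ 4) + ((840) * (rsq z ^ 5) + ((-1528/3) * (rsq z ^ 6) + ((176) * (rsq z ^ 7) + ((-32) * (rsq z ^ 8) + ((64/27) * (rsq z ^ 9)))))))))))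
    ((-1) * fact 0 + ((18) * fact 1 + ((-126) * fact 2 + ((436) * fact 3 + ((-804) * fact 4 + ((840) * fact 5 + ((-1528/3) * fact 6 + ((176) * fact 7 + ((-32) * fact 8 + ((64/27) * fact 9))))))))))"
    by (intro mean_add mean_cmult mean_rsq_power)
  show "(-1) * fact 0 + ((18) * fact 1 + ((-126) * fact 2 + ((436) * fact 3 + ((-804) * fact 4 + ((840) * fact 5 + ((-1528/3) * fact 6 + ((176) * fact 7 + ((-32) * fact 8 + ((64/27) * fact 9))))))))) = (174125 :: real)"
    by (simp add: fact_numeral)
qed (unfold fock3_poly_def, algebra)

lemma mean_fock3_poly_re_cube: "mean (\<lambda>z. fock3_poly (rsq z) * re_cube z) 0"
proof (rule mean_eqI)
  show "mean (\<lambda>z. (-1) * (rsq z ^ 0 * re_cube z) + ((6) * (rsq z ^ 1 * re_cube z) + ((-6) * (rsq z ^ 2 * re_cube z) + ((4/3) * (rsq z ^ 3 * re_cube z)))))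
    ((-1) * 0 + ((6) * 0 + ((-6) * 0 + ((4/3) * 0))))"
    by (intro mean_add mean_cmult mean_rsq_re_cube)
  show "(-1) * 0 + ((6) * 0 + ((-6) * 0 + ((4/3) * 0))) = (0 :: real)"
    by (simp add: fact_numeral)
qed (unfold fock3_poly_def, algebra)

lemma mean_fock3_poly_sq_re_cube: "mean (\<lambda>z. (fock3_poly (rsq z))\<^sup>2 * re_cube z) 0"
proof (rule mean_eqI)
  show "mean (\<lambda>z. (1) * (rsq z ^ 0 * re_cube z) + ((-12) * (rsq z ^ 1 * re_cube z) + ((48) * (rsq z ^ 2 * re_cube z) + ((-224/3) * (rsq z ^ 3 * re_cube z) + ((52) * (rsq z ^ 4 * re_cube z) + ((-16) * (rsq z ^ 5 * re_cube z) + ((16/9) * (rsq z ^ 6 * re_cube z))))))))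
    ((1) * 0 + ((-12) * 0 + ((48) * 0 + ((-224/3) * 0 + ((52) * 0 + ((-16) * 0 + ((16/9) * 0)))))))"
    by (intro mean_add mean_cmult mean_rsq_re_cube)
  show "(1) * 0 + ((-12) * 0 + ((48) * 0 + ((-224/3) * 0 + ((52) * 0 + ((-16) * 0 + ((16/9) * 0)))))) = (0 :: real)"
    by (simp add: fact_numeral)
qed (unfold fock3_poly_def, algebra)

lemma mean_fock3_poly_re_cube_sq: "mean (\<lambda>z. fock3_poly (rsq z) * (re_cube z)\<^sup>2) 189"
proof (rule mean_eqI)
  show "mean (\<lambda>z. (-1) * (rsq z ^ 0 * (re_cube z)\<^sup>2) + ((6) * (rsq z ^ 1 * (re_cube z)\<^sup>2) + ((-6) * (rsq z ^ 2 * (re_cube z)\<^sup>2) + ((4/3) * (rsq z ^ 3 * (re_cube z)\<^sup>2)))))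
    ((-1) * (fact (0 + 3) / 2) + ((6) * (fact (1 + 3) / 2) + ((-6) * (fact (2 + 3) / 2) + ((4/3) * (fact (3 + 3) / 2)))))"
    by (intro mean_add mean_cmult mean_rsq_re_cube_sq)
  show "(-1) * (fact (0 + 3) / 2) + ((6) * (fact (1 + 3) / 2) + ((-6) * (fact (2 + 3) / 2) + ((4/3) * (fact (3 + 3) / 2)))) = (189 :: real)"
    by (simp add: fact_numeral)
qed (unfold fock3_poly_def, algebra)

subsection \<open>Positivity and relative entropy\<close>

text \<open>The difference of the two sides has derivative \<open>u\<^sup>2 / (1 + u)\<close>, so it
  increases through its zero at 0.\<close>

lemma ln_one_plus_quadratic:
  fixes x :: real
  assumes "-1 < x"
  shows "0 \<le> x \<Longrightarrow> x - x\<^sup>2 / 2 \<le> ln (1 + x)" and "x \<le> 0 \<Longrightarrow> ln (1 + x) \<le> x - x\<^sup>2 / 2"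
proof -
  let ?f = "\<lambda>x::real. ln (1 + x) - x + x\<^sup>2 / 2"
  have mono: "?f a \<le> ?f b" if "-1 < a" "a \<le> b" for a b
  proof (rule DERIV_nonneg_imp_nondecreasing[OF \<open>a \<le> b\<close>])
    fix u assume "a \<le> u" "u \<le> b"
    with that have "0 < 1 + u" by simp
    then have "(?f has_real_derivative u\<^sup>2 / (1 + u)) (at u)"
      by (auto intro!: derivative_eq_intros simp: field_simps power2_eq_square)
    with \<open>0 < 1 + u\<close> show "\<exists>y. (?f has_real_derivative y) (at u) \<and> 0 \<le> y"
      by (intro exI[of _ "u\<^sup>2 / (1 + u)"]) auto
  qed
  show "0 \<le> x \<Longrightarrow> x - x\<^sup>2 / 2 \<le> ln (1 + x)" "x \<le> 0 \<Longrightarrow> ln (1 + x) \<le> x - x\<^sup>2 / 2"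
    using mono[of 0 x] mono[of x 0] assms by auto
qed

text \<open>The left side is the cubic Taylor polynomial at 0. The derivative of the difference is
  \<open>ln (1 + u) - (u - u\<^sup>2 / 2)\<close>, which changes sign at 0, so the minimum is there.
  Validity on the whole half-line matters because the Wigner ratio is unbounded.\<close>

lemma one_plus_times_ln_ge:
  fixes x :: real
  assumes "-1 < x"
  shows "x + x\<^sup>2 / 2 - x ^ 3 / 6 \<le> (1 + x) * ln (1 + x)"
proof -
  let ?f = "\<lambda>x::real. (1 + x) * ln (1 + x) - (x + x\<^sup>2 / 2 - x ^ 3 / 6)"
  have d: "(?f has_real_derivative ln (1 + u) - (u - u\<^sup>2 / 2)) (at u)" if "-1 < u" for u
    using that by (auto intro!: derivative_eq_intros)
  have "?f 0 \<le> ?f x"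
  proof (cases "0 \<le> x")
    case True
    show ?thesis
    proof (rule DERIV_nonneg_imp_nondecreasing[OF True])
      fix u :: real assume "0 \<le> u"
      then show "\<exists>y. (?f has_real_derivative y) (at u) \<and> 0 \<le> y"
        using d[of u] ln_one_plus_quadratic(1)[of u]
        by (intro exI[of _ "ln (1 + u) - (u - u\<^sup>2 / 2)"]) auto
    qed
  next
    case False
    then have "x \<le> 0" by simp
    then show ?thesis
    proof (rule DERIV_nonpos_imp_nonincreasing)
      fix u :: real assume "x \<le> u" "u \<le> 0"
      with assms show "\<exists>y. (?f has_real_derivative y) (at u) \<and> y \<le> 0"
        using d[of u] ln_one_plus_quadratic(2)[of u]
        by (intro exI[of _ "ln (1 + u) - (u - u\<^sup>2 / 2)"]) auto
    qed
  qed
  then show ?thesis by simp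
qed

text \<open>A crude bound whose purpose is integrability: it dominates the entropy integrand by a
  polynomial moment.\<close>

lemma abs_times_ln_le:
  fixes x :: real
  assumes "0 < x"
  shows "\<bar>x * ln x\<bar> \<le> 1 + x\<^sup>2"
proof -
  have "x * ln x \<le> x * (x - 1)"
    using assms ln_le_minus_one[of x] by (intro mult_left_mono) auto
  then have "x * ln x \<le> x\<^sup>2 - x"
    by (simp add: power2_eq_square right_diff_distrib)
  moreover have "x - 1 \<le> x * ln x"
  proof -
    have "1 - inverse x \<le> ln x"
      using assms ln_le_minus_one[of "inverse x"] by (simp add: ln_inverse)
    then have "x * (1 - inverse x) \<le> x * ln x"
      using assms by (intro mult_left_mono) auto
    then show ?thesis
      using assms by (simp add: right_diff_distrib)
  qed
  ultimately show ?thesis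
    using assms zero_le_power2[of x] by linarith
qed

text \<open>The Wigner function of the state over \<open>W0\<close>, up to the normalisation
  \<open>1 + t\<^sup>2\<close>. The coefficient 6/5 sqrt 3 is 9/10 times 4 / sqrt 3.\<close>

definition wigner_ratio :: "real \<Rightarrow> real \<times> real \<Rightarrow> real" where
  "wigner_ratio t z = 1 + (t\<^sup>2 * fock3_poly (rsq z) + 6 / 5 * sqrt 3 * t * re_cube z)"

text \<open>The gap is the square of the imaginary part of (q + i p)^3.\<close>

lemma re_cube_sq_le: "(re_cube z)\<^sup>2 \<le> rsq z ^ 3"
proof -
  have "rsq z ^ 3 - (re_cube z)\<^sup>2 = (snd z ^ 3 - 3 * (fst z)\<^sup>2 * snd z)\<^sup>2"
    unfolding rsq_def re_cube_def by algebra
  then show ?thesis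
    using zero_le_power2[of "snd z ^ 3 - 3 * (fst z)\<^sup>2 * snd z"] by linarith
qed

text \<open>Of the leading coefficient 4/3 of \<open>fock3_poly\<close>, the share 6/5 absorbs the
  interference term and 2/15 remains. In 1801, the part 1800 keeps the remaining cubic nonnegative
  and 1 offsets the constant -1 of \<open>fock3_poly\<close>.\<close>

lemma wigner_ratio_ge: "1 / 10 - 1801 * t\<^sup>2 \<le> wigner_ratio t z"
proof -
  define r where "r = rsq z"
  have "0 \<le> r" by (simp add: r_def rsq_def)
  \<comment> \<open>\<open>59 / 2\<close> is close to the positive critical point of the cubic.\<close>
  have cubic: "0 \<le> 1800 + 6 * r - 6 * r\<^sup>2 + 2 / 15 * r ^ 3"
  proof -
    \<comment> \<open>The shift 14 matches the quadratic coefficient, as 2/15 * (14 - 59) = -6; the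
      affine remainder then has positive coefficients.\<close>
    have "1800 + 6 * r - 6 * r\<^sup>2 + 2 / 15 * r ^ 3 =
      2 / 15 * ((r + 14) * (r - 59 / 2)\<^sup>2) + (1800 - 2 / 15 * 14 * (59/2)\<^sup>2 + (6 - 2/15 * ((59/2)\<^sup>2 - 14 * 59)) * r)"
      by (simp add: field_simps power2_eq_square power3_eq_cube)
    moreover have "0 \<le> (r + 14) * (r - 59 / 2)\<^sup>2"
      using \<open>0 \<le> r\<close> by simp
    ultimately show ?thesis
      using \<open>0 \<le> r\<close> by (simp add: power2_eq_square)
  qed
  \<comment> \<open>AM-GM splits the interference term into \<open>9/10\<close> and a share of the leading term of \<open>t\<^sup>2 * fock3_poly r\<close>.\<close>
  have "0 \<le> (9 / 10 + 2 / 3 * sqrt 3 * (9 / 10) * t * re_cube z)\<^sup>2"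
    by simp
  also have "\<dots> = 9 / 10 * (9 / 10 + 6 / 5 * sqrt 3 * t * re_cube z + 6 / 5 * t\<^sup>2 * (re_cube z)\<^sup>2)"
    by (simp add: power2_sum power_mult_distrib) (simp add: power2_eq_square algebra_simps)
  finally have "- (9 / 10) - 6 / 5 * t\<^sup>2 * (re_cube z)\<^sup>2 \<le> 6 / 5 * sqrt 3 * t * re_cube z"
    by simp
  moreover have "6 / 5 * t\<^sup>2 * (re_cube z)\<^sup>2 \<le> 6 / 5 * t\<^sup>2 * r ^ 3"
    using re_cube_sq_le[of z] by (intro mult_left_mono) (auto simp: r_def)
  moreover have "0 \<le> t\<^sup>2 * (1800 + 6 * r - 6 * r\<^sup>2 + 2 / 15 * r ^ 3)"
    using cubic by simp
  ultimately show ?thesis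
    by (simp add: wigner_ratio_def fock3_poly_def r_def[symmetric] algebra_simps)
qed

section \<open>Moments of the Wigner ratio\<close>

lemma mean_wigner_ratio: "mean (wigner_ratio t) (1 + t\<^sup>2)"
proof (rule mean_eqI)
  show "mean (\<lambda>z. rsq z ^ 0 + (t\<^sup>2 * fock3_poly (rsq z) + 6 / 5 * sqrt 3 * t * (rsq z ^ 0 * re_cube z)))
    (fact 0 + (t\<^sup>2 * 1 + 6 / 5 * sqrt 3 * t * 0))"
    by (intro mean_add mean_cmult mean_fock3_poly mean_rsq_re_cube mean_rsq_power)
qed (auto simp: wigner_ratio_def)

lemma mean_wigner_ratio_rsq: "mean (\<lambda>z. wigner_ratio t z * rsq z) (1 + 7 * t\<^sup>2)"
proof (rule mean_eqI)
  show "mean (\<lambda>z. rsq z ^ 1 + (t\<^sup>2 * (fock3_poly (rsq z) * rsq z) + 6 / 5 * sqrt 3 * t * (rsq z ^ 1 * re_cube z)))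
    (fact 1 + (t\<^sup>2 * 7 + 6 / 5 * sqrt 3 * t * 0))"
    by (intro mean_add mean_cmult mean_fock3_poly_rsq mean_rsq_re_cube mean_rsq_power)
qed (auto simp: wigner_ratio_def algebra_simps)

text \<open>The order t^2 part comes from the interference term alone: (6/5 sqrt 3)^2 * 3 = 324/25.
  Half of it is the 6.48 t^2 of the relative entropy.\<close>

lemma mean_wigner_ratio_minus_one_sq:
  "mean (\<lambda>z. (wigner_ratio t z - 1)\<^sup>2) (245 * t ^ 4 + 324 / 25 * t\<^sup>2)"
proof (rule mean_eqI)
  let ?e = "6 / 5 * sqrt 3 * t"
  show "mean (\<lambda>z. t ^ 4 * (fock3_poly (rsq z))\<^sup>2 + (2 * t\<^sup>2 * ?e * (fock3_poly (rsq z) * re_cube z)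
      + ?e\<^sup>2 * (rsq z ^ 0 * (re_cube z)\<^sup>2))) (t ^ 4 * 245 + (2 * t\<^sup>2 * ?e * 0 + ?e\<^sup>2 * (fact (0 + 3) / 2)))"
    by (intro mean_add mean_cmult mean_fock3_poly_sq mean_fock3_poly_re_cube mean_rsq_re_cube_sq)
  show "t ^ 4 * 245 + (2 * t\<^sup>2 * ?e * 0 + ?e\<^sup>2 * (fact (0 + 3) / 2)) = 245 * t ^ 4 + 324 / 25 * t\<^sup>2"
    by (simp add: power_mult_distrib power_divide fact_numeral)
  show "t ^ 4 * (fock3_poly (rsq (q, p)))\<^sup>2 + (2 * t\<^sup>2 * ?e * (fock3_poly (rsq (q, p)) * re_cube (q, p))
      + ?e\<^sup>2 * (rsq (q, p) ^ 0 * (re_cube (q, p))\<^sup>2)) = (wigner_ratio t (q, p) - 1)\<^sup>2" for q p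
    unfolding wigner_ratio_def by algebra
qed

text \<open>The order t^3 part is a multiple of the mean of \<open>re_cube z ^ 3\<close>, which
  vanishes, so the cubic term costs only order t^4.\<close>

lemma mean_wigner_ratio_minus_one_cubed:
  "mean (\<lambda>z. (wigner_ratio t z - 1) ^ 3) (174125 * t ^ 6 + 61236 / 25 * t ^ 4)"
proof (rule mean_eqI)
  let ?e = "6 / 5 * sqrt 3 * t"
  show "mean (\<lambda>z. t ^ 6 * fock3_poly (rsq z) ^ 3 + (3 * t ^ 4 * ?e * ((fock3_poly (rsq z))\<^sup>2 * re_cube z)
      + (3 * t\<^sup>2 * ?e\<^sup>2 * (fock3_poly (rsq z) * (re_cube z)\<^sup>2) + ?e ^ 3 * re_cube z ^ 3)))
      (t ^ 6 * 174125 + (3 * t ^ 4 * ?e * 0 + (3 * t\<^sup>2 * ?e\<^sup>2 * 189 + ?e ^ 3 * 0)))"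
    by (intro mean_add mean_cmult mean_fock3_poly_cubed mean_fock3_poly_sq_re_cube
        mean_fock3_poly_re_cube_sq mean_re_cube_cubed)
  show "t ^ 6 * 174125 + (3 * t ^ 4 * ?e * 0 + (3 * t\<^sup>2 * ?e\<^sup>2 * 189 + ?e ^ 3 * 0)) =
      174125 * t ^ 6 + 61236 / 25 * t ^ 4"
    by (simp add: power_mult_distrib power_divide)
  show "t ^ 6 * fock3_poly (rsq (q, p)) ^ 3 + (3 * t ^ 4 * ?e * ((fock3_poly (rsq (q, p)))\<^sup>2 * re_cube (q, p))
      + (3 * t\<^sup>2 * ?e\<^sup>2 * (fock3_poly (rsq (q, p)) * (re_cube (q, p))\<^sup>2) + ?e ^ 3 * re_cube (q, p) ^ 3)) =
      (wigner_ratio t (q, p) - 1) ^ 3" for q p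
    unfolding wigner_ratio_def by algebra
qed

lemma measurable_wigner_ratio [measurable]: "wigner_ratio t \<in> borel_measurable borel"
  unfolding wigner_ratio_def fock3_poly_def rsq_def re_cube_def
  by (intro borel_measurable_continuous_onI continuous_intros)

lemma measurable_W0 [measurable]: "W0 \<in> borel_measurable borel"
  unfolding W0_def split_beta by (intro borel_measurable_continuous_onI continuous_intros) auto

text \<open>The integrand is not polynomial, so domination gives only the existence of the mean
  \<open>v\<close>; integrating \<open>one_plus_times_ln_ge\<close> at \<open>?G z - 1\<close>
  bounds it from below.\<close>

lemma mean_wigner_ratio_ln:
  assumes pos: "\<And>z. 0 < wigner_ratio t z"
  obtains v where "mean (\<lambda>z. wigner_ratio t z * ln (wigner_ratio t z)) v"
    and "t\<^sup>2 + (245 * t ^ 4 + 324 / 25 * t\<^sup>2) / 2 - (174125 * t ^ 6 + 61236 / 25 * t ^ 4) / 6 \<le> v"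
proof -
  let ?G = "wigner_ratio t"
  have W0_nonneg: "0 \<le> W0 z" for z
    by (simp add: W0_def split_beta)
  \<comment> \<open>This combination is \<open>1 + (?G z)\<^sup>2\<close> written through known
    means; \<open>rsq z ^ 0\<close> stands for the constant 1.\<close>
  have "mean (\<lambda>z. rsq z ^ 0 + ((?G z - 1)\<^sup>2 + (2 * ?G z + (-1) * rsq z ^ 0)))
     (fact 0 + ((245 * t ^ 4 + 324 / 25 * t\<^sup>2) + (2 * (1 + t\<^sup>2) + (-1) * fact 0)))"
    by (intro mean_add mean_cmult mean_rsq_power mean_wigner_ratio mean_wigner_ratio_minus_one_sq)
  then have "integrable lborel (\<lambda>z. W0 z * (1 + (?G z)\<^sup>2))"
    by (simp add: mean_def has_bochner_integral_iff power2_eq_square algebra_simps)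
  then have "integrable lborel (\<lambda>z. W0 z * (?G z * ln (?G z)))"
  proof (rule Bochner_Integration.integrable_bound)
    show "AE z in lborel. norm (W0 z * (?G z * ln (?G z))) \<le> norm (W0 z * (1 + (?G z)\<^sup>2))"
      using abs_times_ln_le[OF pos] W0_nonneg
      by (intro AE_I2) (simp add: abs_mult[of "W0 _"] mult_left_mono)
  qed measurable
  then obtain v where v: "mean (\<lambda>z. ?G z * ln (?G z)) v"
    by (auto simp: mean_def has_bochner_integral_iff)
  have lower: "mean (\<lambda>z. (?G z + (-1) * rsq z ^ 0) + (1 / 2 * (?G z - 1)\<^sup>2 + (-1 / 6) * (?G z - 1) ^ 3))
     ((1 + t\<^sup>2 + (-1) * fact 0) + (1 / 2 * (245 * t ^ 4 + 324 / 25 * t\<^sup>2) + (-1 / 6) * (174125 * t ^ 6 + 61236 / 25 * t ^ 4)))"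
    (is "mean ?l ?v")
    by (intro mean_add mean_cmult mean_rsq_power mean_wigner_ratio mean_wigner_ratio_minus_one_sq
        mean_wigner_ratio_minus_one_cubed)
  have "?l z \<le> ?G z * ln (?G z)" for z
    using one_plus_times_ln_ge[of "?G z - 1"] pos[of z] by simp
  then have "?v \<le> v"
    using lower v unfolding mean_def has_bochner_integral_iff
    by (metis (no_types, lifting) W0_nonneg integral_mono mult_left_mono)
  with v show ?thesis
    by (intro that[of v]) simp_all
qed

subsection \<open>The Wigner function of the state\<close>

text \<open>The recursion climbs from 0 to 6 through the odd orders, but the Wigner integrand
  involves only the even ones.\<close>

lemma gauss_fourier_even:
  "(\<integral>y. gauss_fourier p 2 y \<partial>lborel) = of_real (sqrt pi * exp (- p\<^sup>2) * (1 / 2 - p\<^sup>2))"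
  "(\<integral>y. gauss_fourier p 4 y \<partial>lborel) = of_real (sqrt pi * exp (- p\<^sup>2) * (3 / 4 - 3 * p\<^sup>2 + p ^ 4))"
  "(\<integral>y. gauss_fourier p 6 y \<partial>lborel) =
     of_real (sqrt pi * exp (- p\<^sup>2) * (15 / 8 - 45 / 4 * p\<^sup>2 + 15 / 2 * p ^ 4 - p ^ 6))"
proof -
  define c :: complex where "c = of_real (sqrt pi * exp (- p\<^sup>2))"
  define P :: complex where "P = of_real p"
  define I where "I k = (\<integral>y. gauss_fourier p k y \<partial>lborel)" for k
  have ii: "\<i> * (\<i> * x) = - x" for x
    by (simp flip: mult.assoc)
  have rec: "I (Suc k) = \<i> * (P * I k) + of_nat k / 2 * I (k - 1)" for k
    using gauss_fourier_Suc[of p k] by (simp add: I_def P_def)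
  have I0: "I 0 = c"
    by (simp add: I_def c_def gauss_fourier_0)
  have I1: "I (Suc 0) = \<i> * (P * c)"
    using rec[of 0] by (simp add: I0)
  have I2: "I 2 = c * (1 / 2 - P\<^sup>2)"
    using rec[of 1] by (simp add: I0 I1 ii numeral_2_eq_2 algebra_simps)
  have I3: "I 3 = \<i> * (c * (3 / 2 * P - P ^ 3))"
    using rec[of 2] by (simp add: I1 I2 ii power_numeral_reduce algebra_simps)
  have I4: "I 4 = c * (3 / 4 - 3 * P\<^sup>2 + P ^ 4)"
    using rec[of 3] by (simp add: I2 I3 ii power_numeral_reduce algebra_simps)
  have I5: "I 5 = \<i> * (c * (15 / 4 * P - 5 * P ^ 3 + P ^ 5))"
    using rec[of 4] by (simp add: I3 I4 ii power_numeral_reduce algebra_simps)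
  have I6: "I 6 = c * (15 / 8 - 45 / 4 * P\<^sup>2 + 15 / 2 * P ^ 4 - P ^ 6)"
    using rec[of 5] by (simp add: I4 I5 ii power_numeral_reduce algebra_simps)
  show "(\<integral>y. gauss_fourier p 2 y \<partial>lborel) = of_real (sqrt pi * exp (- p\<^sup>2) * (1 / 2 - p\<^sup>2))"
    "(\<integral>y. gauss_fourier p 4 y \<partial>lborel) = of_real (sqrt pi * exp (- p\<^sup>2) * (3 / 4 - 3 * p\<^sup>2 + p ^ 4))"
    "(\<integral>y. gauss_fourier p 6 y \<partial>lborel) =
     of_real (sqrt pi * exp (- p\<^sup>2) * (15 / 8 - 45 / 4 * p\<^sup>2 + 15 / 2 * p ^ 4 - p ^ 6))"
    using I2 I4 I6 by (simp_all add: I_def c_def P_def)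
qed

text \<open>Odd powers of \<open>y\<close> cancel because the vacuum and Fock-3 prefactors are real
  and enter the kernel symmetrically under the exchange of \<open>q - y\<close> and
  \<open>q + y\<close>.\<close>

lemma wigner_integrand:
  assumes "is_vacuum \<psi>" and b_def: "b = 9 / 10 * t / sqrt 3"
  shows "exp (2 * \<i> * of_real p * of_real y) * sigma_state \<psi> t (q - y) (q + y) =
    of_real (exp (- q\<^sup>2) / (sqrt pi * (1 + t\<^sup>2))) *
     (of_real (1 + t\<^sup>2 / 3 * (4 * q ^ 6 - 12 * q ^ 4 + 9 * q\<^sup>2) + b * (4 * q ^ 3 - 6 * q)) * gauss_fourier p 0 y +
      of_real (b * (12 * q) - t\<^sup>2 / 3 * (12 * q ^ 4 + 9)) * gauss_fourier p 2 y +
      of_real (t\<^sup>2 / 3 * (12 * q\<^sup>2 + 12)) * gauss_fourier p 4 y +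
      of_real (- (4 / 3) * t\<^sup>2) * gauss_fourier p 6 y)"
proof -
  obtain c where c: "\<psi> = (\<lambda>x. c * of_real (exp (- x\<^sup>2 / 2)))" "c * cnj c = of_real (1 / sqrt pi)"
    using vacuum_eq_gaussian[OF assms(1)] .
  define g where "g = (\<lambda>x::real. (2 * x ^ 3 - 3 * x) / sqrt 3)"
  define E where "E = exp (2 * \<i> * complex_of_real p * of_real y)"
  have exp: "exp (- (q - y)\<^sup>2 / 2) * exp (- (q + y)\<^sup>2 / 2) = exp (- q\<^sup>2) * exp (- y\<^sup>2)"
    by (simp add: power2_eq_square field_simps flip: exp_add)
  have "\<psi> (q - y) * cnj (\<psi> (q + y)) =
      (c * cnj c) * of_real (exp (- (q - y)\<^sup>2 / 2) * exp (- (q + y)\<^sup>2 / 2))"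
    by (simp add: c(1) mult_ac)
  also have "\<dots> = of_real (exp (- q\<^sup>2) * exp (- y\<^sup>2) / sqrt pi)"
    unfolding exp c(2) by simp
  finally have vac: "\<psi> (q - y) * cnj (\<psi> (q + y)) = of_real (exp (- q\<^sup>2) * exp (- y\<^sup>2) / sqrt pi)" .
  have fock: "fock \<psi> 3 = (\<lambda>x. of_real (g x) * \<psi> x)" "fock \<psi> 0 = \<psi>"
    using fock_3[OF assms(1)] by (simp_all add: g_def fock_0)
  have "sigma_state \<psi> t (q - y) (q + y) =
      \<psi> (q - y) * cnj (\<psi> (q + y)) * of_real (1 + t\<^sup>2 * (g (q - y) * g (q + y)) + 9 / 10 * t * (g (q + y) + g (q - y)))
       / of_real (1 + t\<^sup>2)"
    by (simp add: sigma_state_def ketbra_def fock algebra_simps)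
  also have "g (q - y) * g (q + y) =
      1 / 3 * (4 * q ^ 6 - 12 * q ^ 4 + 9 * q\<^sup>2 - (12 * q ^ 4 + 9) * y\<^sup>2 + (12 * q\<^sup>2 + 12) * y ^ 4 - 4 * y ^ 6)"
  proof -
    have "(2 * (q - y) ^ 3 - 3 * (q - y)) * (2 * (q + y) ^ 3 - 3 * (q + y)) =
      4 * q ^ 6 - 12 * q ^ 4 + 9 * q\<^sup>2 - (12 * q ^ 4 + 9) * y\<^sup>2 + (12 * q\<^sup>2 + 12) * y ^ 4 - 4 * y ^ 6"
      by algebra
    then show ?thesis
      by (simp add: g_def)
  qed
  also have "9 / 10 * t * (g (q + y) + g (q - y)) = b * (4 * q ^ 3 - 6 * q + 12 * q * y\<^sup>2)"
  proof -
    have "(2 * (q + y) ^ 3 - 3 * (q + y)) + (2 * (q - y) ^ 3 - 3 * (q - y)) = 4 * q ^ 3 - 6 * q + 12 * q * y\<^sup>2"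
      by algebra
    then show ?thesis
      by (simp only: g_def b_def flip: add_divide_distrib) simp
  qed
  finally have \<sigma>: "sigma_state \<psi> t (q - y) (q + y) = of_real (exp (- q\<^sup>2) / (sqrt pi * (1 + t\<^sup>2)) * (exp (- y\<^sup>2) *
      (1 + t\<^sup>2 * (1 / 3 * (4 * q ^ 6 - 12 * q ^ 4 + 9 * q\<^sup>2 - (12 * q ^ 4 + 9) * y\<^sup>2 + (12 * q\<^sup>2 + 12) * y ^ 4 - 4 * y ^ 6))
        + b * (4 * q ^ 3 - 6 * q + 12 * q * y\<^sup>2))))"
    unfolding vac by (simp add: mult_ac)
  have split: "exp (- y\<^sup>2) *
      (1 + t\<^sup>2 * (1 / 3 * (4 * q ^ 6 - 12 * q ^ 4 + 9 * q\<^sup>2 - (12 * q ^ 4 + 9) * y\<^sup>2 + (12 * q\<^sup>2 + 12) * y ^ 4 - 4 * y ^ 6))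
        + b * (4 * q ^ 3 - 6 * q + 12 * q * y\<^sup>2)) =
      (1 + t\<^sup>2 / 3 * (4 * q ^ 6 - 12 * q ^ 4 + 9 * q\<^sup>2) + b * (4 * q ^ 3 - 6 * q)) * (y ^ 0 * exp (- y\<^sup>2)) +
      (b * (12 * q) - t\<^sup>2 / 3 * (12 * q ^ 4 + 9)) * (y\<^sup>2 * exp (- y\<^sup>2)) +
      (t\<^sup>2 / 3 * (12 * q\<^sup>2 + 12)) * (y ^ 4 * exp (- y\<^sup>2)) + (- (4 / 3) * t\<^sup>2) * (y ^ 6 * exp (- y\<^sup>2))"
    by (simp add: field_simps)
  show ?thesis
    unfolding \<sigma> split gauss_fourier_def E_def[symmetric] of_real_mult[of "_ / (_ * _)"] of_real_add
      of_real_mult[of _ "_ * exp _"]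
    by (simp only: algebra_simps)
qed

lemma wigner_sigma_state:
  assumes "is_vacuum \<psi>"
  shows "wigner (sigma_state \<psi> t) z = of_real (W0 z * (wigner_ratio t z / (1 + t\<^sup>2)))"
proof -
  obtain q p where z: "z = (q, p)" by fastforce
  define b where "b = 9 / 10 * t / sqrt 3"
  let ?K = "exp (- q\<^sup>2) / (sqrt pi * (1 + t\<^sup>2))"
  let ?c0 = "1 + t\<^sup>2 / 3 * (4 * q ^ 6 - 12 * q ^ 4 + 9 * q\<^sup>2) + b * (4 * q ^ 3 - 6 * q)"
  let ?c2 = "b * (12 * q) - t\<^sup>2 / 3 * (12 * q ^ 4 + 9)"
  let ?c4 = "t\<^sup>2 / 3 * (12 * q\<^sup>2 + 12)"
  let ?c6 = "- (4 / 3) * t\<^sup>2"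
  let ?M = "sqrt pi * exp (- p\<^sup>2)"
  have "(\<integral>y. exp (2 * \<i> * of_real p * of_real y) * sigma_state \<psi> t (q - y) (q + y) \<partial>lborel) =
    of_real ?K * (of_real ?c0 * (\<integral>y. gauss_fourier p 0 y \<partial>lborel) + of_real ?c2 * (\<integral>y. gauss_fourier p 2 y \<partial>lborel)
      + of_real ?c4 * (\<integral>y. gauss_fourier p 4 y \<partial>lborel) + of_real ?c6 * (\<integral>y. gauss_fourier p 6 y \<partial>lborel))"
    by (simp only: wigner_integrand[OF assms b_def] integral_mult_right_zero Bochner_Integration.integral_add
        Bochner_Integration.integrable_add integrable_mult_right integrable_gauss_fourier)
  also have "\<dots> = of_real (?K * (?c0 * ?M + ?c2 * (?M * (1 / 2 - p\<^sup>2)) + ?c4 * (?M * (3 / 4 - 3 * p\<^sup>2 + p ^ 4))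
      + ?c6 * (?M * (15 / 8 - 45 / 4 * p\<^sup>2 + 15 / 2 * p ^ 4 - p ^ 6))))"
    by (simp only: gauss_fourier_0 gauss_fourier_even of_real_mult of_real_add)
  \<comment> \<open>The powers of q and p regroup into a rotation-invariant part and a multiple of
    the real part of (q + i p)^3.\<close>
  also have "?c0 * ?M + ?c2 * (?M * (1 / 2 - p\<^sup>2)) + ?c4 * (?M * (3 / 4 - 3 * p\<^sup>2 + p ^ 4))
      + ?c6 * (?M * (15 / 8 - 45 / 4 * p\<^sup>2 + 15 / 2 * p ^ 4 - p ^ 6)) =
      ?M * (1 + t\<^sup>2 * fock3_poly (q\<^sup>2 + p\<^sup>2) + 4 * b * (q ^ 3 - 3 * q * p\<^sup>2))"
    unfolding fock3_poly_def by (simp add: field_simps) algebra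
  also have "4 * b = 6 / 5 * sqrt 3 * t"
    by (simp add: b_def field_simps)
  finally have "wigner (sigma_state \<psi> t) z = of_real (1 / pi * (?K *
      (?M * (1 + t\<^sup>2 * fock3_poly (q\<^sup>2 + p\<^sup>2) + 6 / 5 * sqrt 3 * t * (q ^ 3 - 3 * q * p\<^sup>2)))))"
    by (simp add: wigner_def z)
  also have "1 / pi * (?K * (?M * (1 + t\<^sup>2 * fock3_poly (q\<^sup>2 + p\<^sup>2) + 6 / 5 * sqrt 3 * t * (q ^ 3 - 3 * q * p\<^sup>2)))) =
      W0 z * (wigner_ratio t z / (1 + t\<^sup>2))"
  proof -
    have "exp (- q\<^sup>2 - p\<^sup>2) = exp (- q\<^sup>2) * exp (- p\<^sup>2)"
      by (simp flip: exp_add)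
    then show ?thesis
      by (simp add: W0_def z wigner_ratio_def rsq_def re_cube_def add.assoc)
  qed
  finally show ?thesis .
qed

section \<open>Assembly of the entropy estimate\<close>

theorem theorem1:
  fixes t :: real and \<psi>0 :: wavefun
  assumes "is_vacuum \<psi>0" and "0 < \<bar>t\<bar>" and "\<bar>t\<bar> \<le> 1 / 200"
  defines "W \<equiv> wigner (sigma_state \<psi>0 t)"
  shows "(\<forall>q p. W (q, p) \<in> \<real> \<and>
            Re (W (q, p)) \<ge> (1 / 10 - 1801 * t\<^sup>2) / (1 + t\<^sup>2) * W0 (q, p) \<and>
            (1 / 10 - 1801 * t\<^sup>2) / (1 + t\<^sup>2) * W0 (q, p) > 0) \<and>
         integrable lborel (\<lambda>z. Re (W z) * ln (Re (W z))) \<and>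
         diff_entropy (\<lambda>z. Re (W z)) - (1 + ln pi) < - (47 / 100) * t\<^sup>2"
proof -
  define N where "N = 1 + t\<^sup>2"
  let ?G = "wigner_ratio t"
  have W: "W z = of_real (W0 z * (?G z / N))" for z
    by (simp add: W_def N_def wigner_sigma_state assms)
  have "0 < t\<^sup>2" using assms by simp
  then have "0 < N" by (simp add: N_def add_pos_nonneg)
  have "\<bar>t\<bar>\<^sup>2 \<le> (1 / 200)\<^sup>2"
    using assms by (intro power_mono) auto
  then have t2: "t\<^sup>2 \<le> 1 / 40000" by (simp add: power_divide)
  have W0_pos: "0 < W0 z" for z by (simp add: W0_def split_beta)
  have bound_pos: "0 < 1 / 10 - 1801 * t\<^sup>2" using t2 by simp
  then have G_pos: "0 < ?G z" for z using wigner_ratio_ge[of t z] by simp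
  have pointwise: "W (q, p) \<in> \<real> \<and> Re (W (q, p)) \<ge> (1 / 10 - 1801 * t\<^sup>2) / (1 + t\<^sup>2) * W0 (q, p) \<and>
            (1 / 10 - 1801 * t\<^sup>2) / (1 + t\<^sup>2) * W0 (q, p) > 0" for q p
  proof (intro conjI)
    show "W (q, p) \<in> \<real>" by (simp only: W Reals_of_real)
    show "Re (W (q, p)) \<ge> (1 / 10 - 1801 * t\<^sup>2) / (1 + t\<^sup>2) * W0 (q, p)"
      using wigner_ratio_ge[of t "(q, p)"] \<open>0 < N\<close> W0_pos[of "(q, p)"]
      by (simp add: W N_def[symmetric] mult.commute[of _ "W0 _"] divide_right_mono mult_left_mono)
    show "(1 / 10 - 1801 * t\<^sup>2) / (1 + t\<^sup>2) * W0 (q, p) > 0"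
      using bound_pos \<open>0 < N\<close> W0_pos by (simp add: N_def)
  qed
  obtain v where v: "mean (\<lambda>z. ?G z * ln (?G z)) v"
    and v_ge: "t\<^sup>2 + (245 * t ^ 4 + 324 / 25 * t\<^sup>2) / 2 - (174125 * t ^ 6 + 61236 / 25 * t ^ 4) / 6 \<le> v"
    using mean_wigner_ratio_ln[OF G_pos] by blast
  \<comment> \<open>Splitting the logarithm of \<open>W0 z * (?G z / N)\<close> gives
    \<open>- rsq z - ln pi + ln (?G z) - ln N\<close>; after weighting with \<open>?G z / N\<close>,
    every term has a known mean except the relative entropy term \<open>v\<close>.\<close>
  have "mean (\<lambda>z. 1 / N * (?G z * ln (?G z) + ((- ln N - ln pi) * ?G z + (-1) * (?G z * rsq z))))
      (1 / N * (v + ((- ln N - ln pi) * (1 + t\<^sup>2) + (-1) * (1 + 7 * t\<^sup>2))))"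
    by (intro mean_add mean_cmult v mean_wigner_ratio mean_wigner_ratio_rsq)
  moreover have "W0 z * (1 / N * (?G z * ln (?G z) + ((- ln N - ln pi) * ?G z + (-1) * (?G z * rsq z)))) =
      Re (W z) * ln (Re (W z))" for z
  proof -
    have "W0 z = exp (- rsq z) / pi"
      by (simp add: W0_def rsq_def split_beta)
    then have "ln (W0 z) = - rsq z - ln pi"
      by (simp add: ln_div)
    then have "ln (W0 z * (?G z / N)) = - rsq z - ln pi + (ln (?G z) - ln N)"
      using W0_pos[of z] G_pos[of z] \<open>0 < N\<close> by (simp add: ln_mult ln_div)
    then show ?thesis
      by (simp add: W) (simp add: field_simps)
  qed
  ultimately have ent: "has_bochner_integral lborel (\<lambda>z. Re (W z) * ln (Re (W z)))
      (1 / N * (v + ((- ln N - ln pi) * (1 + t\<^sup>2) + (-1) * (1 + 7 * t\<^sup>2))))"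
    by (simp only: mean_def)
  then have "diff_entropy (\<lambda>z. Re (W z)) = ln N + ln pi + (1 + 7 * t\<^sup>2 - v) / N"
    using \<open>0 < N\<close> by (simp add: diff_entropy_def has_bochner_integral_integral_eq N_def[symmetric] field_simps)
  moreover have "ln N \<le> t\<^sup>2"
    using ln_add_one_self_le_self[of "t\<^sup>2"] by (simp add: N_def)
  moreover have "t\<^sup>2 + (1 + 7 * t\<^sup>2 - v) / N < 1 - 47 / 100 * t\<^sup>2"
  proof -
    define s where "s = t\<^sup>2"
    have s: "0 < s" "s \<le> 1 / 40000" using \<open>0 < t\<^sup>2\<close> t2 by (simp_all add: s_def)
    have "t ^ 4 = s * s" "t ^ 6 = s * (s * s)" by (simp_all add: s_def flip: power_add power2_eq_square)
    with v_ge have v_ge: "s + (245 * (s * s) + 324 / 25 * s) / 2 - (174125 * (s * (s * s)) + 61236 / 25 * (s * s)) / 6 \<le> v"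
      by (simp add: s_def[symmetric])
    \<comment> \<open>\<open>u\<close> and \<open>w\<close> stand for s^2 and s^3, which makes the
      claim linear. To first order the left side is 1 + 0.52 s against 1 + 0.53 s; the margin 0.01 s
      covers the net s^2 term, with coefficient about 287, and the s^3 term since s is at most
      1/40000.\<close>
    have linear: "u + (1 + 8 * s - v) < 1 + 53 / 100 * s - 47 / 100 * u"
      if "s + (245 * u + 324 / 25 * s) / 2 - (174125 * w + 61236 / 25 * u) / 6 \<le> v"
        and "40000 * u \<le> s" and "40000 * w \<le> u" for u w
      using that s(1) by (simp add: field_simps)
    have "s * s \<le> s * (1 / 40000)" "s * (s * s) \<le> 1 / 40000 * (s * s)"
      using s by (intro mult_left_mono mult_right_mono; simp)+
    then have "40000 * (s * s) \<le> s" "40000 * (s * (s * s)) \<le> s * s"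
      by simp_all
    with v_ge have "s * s + (1 + 8 * s - v) < 1 + 53 / 100 * s - 47 / 100 * (s * s)"
      by (rule linear)
    moreover have "s * (1 + s) + (1 + 7 * s - v) = s * s + (1 + 8 * s - v)"
      by (simp add: algebra_simps)
    moreover have "(1 - 47 / 100 * s) * (1 + s) = 1 + 53 / 100 * s - 47 / 100 * (s * s)"
      by (simp add: field_simps)
    ultimately have "s * (1 + s) + (1 + 7 * s - v) < (1 - 47 / 100 * s) * (1 + s)"
      by (simp only:)
    then show ?thesis
      using \<open>0 < N\<close> by (simp add: N_def s_def[symmetric] field_simps)
  qed
  ultimately have "diff_entropy (\<lambda>z. Re (W z)) - (1 + ln pi) < - (47 / 100) * t\<^sup>2"
    by simp
  with pointwise ent show ?thesis
    by (simp add: has_bochner_integral_iff)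
qed

end
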